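(* In the setting described in the context, suppose that for all $i=1,\dots,n$ and all $x_i\in\operatorname{conv}X_i$ there exists $\hat x_i\in X_i$ such that $A_i\hat x_i\le A_ix_i$. Run the Frank-Wolfe stage for $K\ge1$ iterations with target $z^*=(v^*,b)$, followed by the trimming stage. For each $i$ with $|I_i|>1$ let $\hat x_i\in X_i$ be such that $A_i\hat x_i\le A_i\sum_{l\in I_i}\alpha_ly_i^{k_l}$, and define $\bar x\in\mathbb{R}^d$ by $\bar x_i=\sum_{l\in I_i}\alpha_ly_i^{k_l}$ if $|I_i|=1$ and $\bar x_i=\hat x_i$ if $|I_i|>1$. Then $$\sum_{i=1}^n f_i(\bar x_i)\le v^*+\frac{2D_{\mathcal C}}{\sqrt{K+1}}+(m+1)\max_i\gamma(f_i),$$ $$\Big\|\sum_{i=1}^n A_i\bar x_i-b\Big\|_+\le\frac{2D_{\mathcal C}}{\sqrt{K+1}}.$$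
   Context: Setting. For $i=1,\dots,n$, $f_i:\mathbb{R}^{d_i}\to\mathbb{R}\cup\{+\infty\}$ is proper, lower semicontinuous, has an affine minorant, and $X_i=\operatorname{dom}f_i$ is compact (neither $f_i$ nor $X_i$ is assumed convex). $A_i\in\mathbb{R}^{m\times d_i}$, $b\in\mathbb{R}^m$, $d=\sum_id_i$, $A=[A_1\cdots A_n]$. Vector inequalities are componentwise. $f_i^{**}$ is the Fenchel biconjugate, with $\operatorname{dom}f_i^{**}=\operatorname{conv}X_i$. For a vector $x$, $\|x\|_+=\sqrt{\sum_j\max(x_j,0)^2}$; $\|\cdot\|$ is the Euclidean norm. $\Delta_K=\{\gamma\in\mathbb{R}^K_+:\sum_k\gamma_k=1\}$. Define $\gamma(f_i)=\sup_{x\in X_i}f_i(x)-\inf_{y\in X_i}f_i(y)$. Dual value: $\Psi(\lambda)=\inf_{x_i\in X_i}\{\sum_if_i(x_i)+\lambda^\top(\sum_iA_ix_i-b)\}$ and $v^*=\max_{\lambda\ge0}\Psi(\lambda)$. Strong duality is assumed: $v^*$ equals the optimal value of the problem of minimizing $\sum_if_i^{**}(x_i)$ subject to $Ax\le b$, $x_i\in\operatorname{conv}X_i$. Sets: $\mathcal C_i=\{(f_i^{**}(x_i),A_ix_i):x_i\in\operatorname{conv}X_i\}\subset\mathbb{R}^{1+m}$, $\mathcal C=\sum_i\mathcal C_i$ (Minkowski sum), $D_{\mathcal C}=\sup_{z,z'\in\mathcal C}\|z-z'\|$. Frank-Wolfe stage with target $z^*\in\mathbb{R}^{1+m}$. Start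 from $z^0=\sum_i(f_i(y_i),A_iy_i)$ for some $y_i\in X_i$ with $f_i(y_i)=f_i^{**}(y_i)$. For $k=0,\dots,K-1$: let $v^k=\max(z^k-z^*,0)$ componentwise, written $v^k=(\alpha_k,g^k)\in\mathbb{R}\times\mathbb{R}^m$; for each $i$ choose $y_i^k\in\arg\min_{x_i\in\operatorname{conv}X_i}\{\alpha_kf_i^{**}(x_i)+(g^k)^\top A_ix_i\}$, chosen so that $y_i^k\in X_i$ and $f_i(y_i^k)=f_i^{**}(y_i^k)$ (this choice is a standing assumption); set $s^k=\sum_i(f_i(y_i^k),A_iy_i^k)$ and $z^{k+1}=(1-\eta_k)z^k+\eta_ks^k$, where either $\eta_k=\frac{2}{k+2}$ for all $k$, or $\eta_k=\min\big(1,\frac{(v^k)^\top(z^k-s^k)}{\|z^k-s^k\|^2}\big)$ for all $k$ (any value in $[0,1]$ if $z^k=s^k$). The output is written $z^K=\sum_{k=0}^{K-1}\gamma_ks^k$ with $\gamma\in\Delta_K$ (this representation is part of the setting). Trimming stage. Let $w^K=(z^K,\mathbf 1_n)\in\mathbb{R}^{1+m+n}$, so $w^K=\sum_k\gamma_k\sum_i(f_i(y_i^k),A_iy_i^k,e_i)$ with $e_i$ the canonical basis of $\mathbb{R}^n$. An exact conic Carathéodory algorithm returns $\alpha\in\mathbb{R}^{n+m+1}_+$ and pairs $(i_l,k_l)\in\{1,\dots,n\}\times\{0,\dots,K-1\}$, $l=1,\dots,n+m+1$, with $$w^K=\sum_{l=1}^{n+m+1}\alpha_l\,\big(f_{i_l}(y_{i_l}^{k_l}),\,A_{i_l}y_{i_l}^{k_l},\,e_{i_l}\big).$$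 Set $I_i=\{l:i_l=i\}$. *)

theory Defs
  imports "HOL-Analysis.Analysis"
begin

text \<open>
  The blocks have individual dimensions \<open>d\<^sub>i\<close>, so the spaces \<open>\<real>\<^bsup>d\<^sub>i\<^esup>\<close> are realised inside
  \<open>\<real>\<^sup>d = real ^ 'd\<close>, where \<open>d = \<Sum>\<^sub>i d\<^sub>i\<close>: a map \<open>blk :: 'd \<Rightarrow> 'n\<close> assigns every coordinate to its block,
  \<open>d\<^sub>i\<close> is the number of coordinates mapped to \<open>i\<close>, and \<open>\<real>\<^bsup>d\<^sub>i\<^esup>\<close> is the space of vectors supported
  on block \<open>i\<close>, with the inherited topology and inner product.  For \<open>A = [A\<^sub>1 \<dots> A\<^sub>n] :: real ^ 'd ^ 'm\<close>
  and \<open>x\<close> supported on block \<open>i\<close>, only the columns of \<open>A\<^sub>i\<close> contribute to \<open>A *v x\<close>, which is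
  therefore \<open>A\<^sub>i x\<close>.  A point of \<open>\<real>\<^sup>d\<close> is given by the family of its blocks.
\<close>

definition block_space :: "('d \<Rightarrow> 'n) \<Rightarrow> 'n \<Rightarrow> (real ^ 'd::finite) set" where
  "block_space blk i = {x. \<forall>j. blk j \<noteq> i \<longrightarrow> x $ j = 0}"

text \<open>
  The next notions concern extended real functions on a Euclidean space \<open>E\<close>, given as a subspace of
  an ambient Euclidean space.  Values outside \<open>E\<close> are never used.
\<close>

definition eff_dom :: "'a set \<Rightarrow> ('a \<Rightarrow> ereal) \<Rightarrow> 'a set" where
  "eff_dom E f = {x \<in> E. f x < \<infinity>}"

definition proper_on :: "'a set \<Rightarrow> ('a \<Rightarrow> ereal) \<Rightarrow> bool" where
  "proper_on E f \<longleftrightarrow> (\<forall>x\<in>E. f x \<noteq> -\<infinity>) \<and> (\<exists>x\<in>E. f x \<noteq> \<infinity>)"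

definition lsc_on :: "'a::topological_space set \<Rightarrow> ('a \<Rightarrow> ereal) \<Rightarrow> bool" where
  "lsc_on E f \<longleftrightarrow> (\<forall>x\<in>E. f x \<le> Liminf (at x within E) f)"

definition has_affine_minorant_on :: "'a::real_inner set \<Rightarrow> ('a \<Rightarrow> ereal) \<Rightarrow> bool" where
  "has_affine_minorant_on E f \<longleftrightarrow> (\<exists>a\<in>E. \<exists>c. \<forall>x\<in>E. ereal (a \<bullet> x + c) \<le> f x)"

definition fenchel_conjugate :: "'a::real_inner set \<Rightarrow> ('a \<Rightarrow> ereal) \<Rightarrow> 'a \<Rightarrow> ereal" where
  "fenchel_conjugate E f s = (SUP x\<in>E. ereal (s \<bullet> x) - f x)"

definition biconjugate :: "'a::real_inner set \<Rightarrow> ('a \<Rightarrow> ereal) \<Rightarrow> 'a \<Rightarrow> ereal" where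
  "biconjugate E f = fenchel_conjugate E (fenchel_conjugate E f)"

text \<open>The oscillation \<open>\<gamma>(f)\<close>; it may be infinite, as \<open>f\<close> need not be bounded above on its domain.\<close>

definition gap :: "'a set \<Rightarrow> ('a \<Rightarrow> ereal) \<Rightarrow> ereal" where
  "gap E f = (SUP x\<in>eff_dom E f. f x) - (INF y\<in>eff_dom E f. f y)"

definition norm_plus :: "real ^ 'm::finite \<Rightarrow> real" where
  "norm_plus x = sqrt (\<Sum>j\<in>UNIV. (max (x $ j) 0)\<^sup>2)"

definition dual_function ::
  "('d \<Rightarrow> 'n::finite) \<Rightarrow> ('n \<Rightarrow> real ^ 'd \<Rightarrow> ereal) \<Rightarrow> real ^ 'd::finite ^ 'm::finite \<Rightarrow> real ^ 'm
    \<Rightarrow> real ^ 'm \<Rightarrow> ereal" where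
  "dual_function blk f A b lam =
    (INF x\<in>{x. \<forall>i. x i \<in> eff_dom (block_space blk i) (f i)}.
       (\<Sum>i\<in>UNIV. f i (x i)) + ereal (lam \<bullet> ((\<Sum>i\<in>UNIV. A *v x i) - b)))"

definition convexified_value ::
  "('d \<Rightarrow> 'n::finite) \<Rightarrow> ('n \<Rightarrow> real ^ 'd \<Rightarrow> ereal) \<Rightarrow> real ^ 'd::finite ^ 'm::finite \<Rightarrow> real ^ 'm
    \<Rightarrow> ereal" where
  "convexified_value blk f A b =
    (INF x\<in>{x. (\<forall>i. x i \<in> convex hull (eff_dom (block_space blk i) (f i)))
              \<and> (\<Sum>i\<in>UNIV. A *v x i) \<le> b}.
       \<Sum>i\<in>UNIV. biconjugate (block_space blk i) (f i) (x i))"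

text \<open>
  The set \<open>C\<^sub>i\<close>.  The biconjugate is finite on the convex hull of the domain, so
  \<^const>\<open>real_of_ereal\<close> only changes its type.
\<close>

definition C_block ::
  "('d \<Rightarrow> 'n) \<Rightarrow> ('n \<Rightarrow> real ^ 'd \<Rightarrow> ereal) \<Rightarrow> real ^ 'd::finite ^ 'm::finite \<Rightarrow> 'n
    \<Rightarrow> (real \<times> (real ^ 'm)) set" where
  "C_block blk f A i =
    (\<lambda>x. (real_of_ereal (biconjugate (block_space blk i) (f i) x), A *v x))
      ` (convex hull (eff_dom (block_space blk i) (f i)))"

text \<open>The sum of sets below is the Minkowski sum.\<close>

definition C_sum ::
  "('d \<Rightarrow> 'n::finite) \<Rightarrow> ('n \<Rightarrow> real ^ 'd \<Rightarrow> ereal) \<Rightarrow> real ^ 'd::finite ^ 'm::finite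
    \<Rightarrow> (real \<times> (real ^ 'm)) set" where
  "C_sum blk f A = (\<Sum>i\<in>UNIV. C_block blk f A i)"

text \<open>
  The diameter as an extended real: the library's real-valued \<^const>\<open>diameter\<close> is unspecified on
  unbounded sets, and \<^const>\<open>C_sum\<close> is unbounded if some biconjugate is.
\<close>

definition ediam :: "'a::real_normed_vector set \<Rightarrow> ereal" where
  "ediam C = (SUP z\<in>C. SUP z'\<in>C. ereal (norm (z - z')))"

text \<open>The point \<open>(f\<^sub>i(y), A\<^sub>i y)\<close>, used only for \<open>y\<close> in the domain of \<open>f\<^sub>i\<close>, where \<open>f\<^sub>i(y)\<close> is finite.\<close>

definition image_point ::
  "('n \<Rightarrow> real ^ 'd \<Rightarrow> ereal) \<Rightarrow> real ^ 'd::finite ^ 'm::finite \<Rightarrow> 'n \<Rightarrow> real ^ 'd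
    \<Rightarrow> real \<times> (real ^ 'm)" where
  "image_point f A i y = (real_of_ereal (f i y), A *v y)"

text \<open>
  A run of \<open>K\<close> Frank-Wolfe iterations; \<open>sup _ 0\<close> on \<open>real \<times> (real ^ 'm)\<close> is the componentwise
  positive part.
\<close>

definition fw_direction :: "real \<times> (real ^ 'm::finite) \<Rightarrow> real \<times> (real ^ 'm) \<Rightarrow> real \<times> (real ^ 'm)" where
  "fw_direction zstar z = sup (z - zstar) 0"

definition frank_wolfe_run ::
  "('d \<Rightarrow> 'n::finite) \<Rightarrow> ('n \<Rightarrow> real ^ 'd \<Rightarrow> ereal) \<Rightarrow> real ^ 'd::finite ^ 'm::finite
    \<Rightarrow> real \<times> (real ^ 'm) \<Rightarrow> nat \<Rightarrow> ('n \<Rightarrow> real ^ 'd) \<Rightarrow> (nat \<Rightarrow> 'n \<Rightarrow> real ^ 'd)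
    \<Rightarrow> (nat \<Rightarrow> real) \<Rightarrow> (nat \<Rightarrow> real \<times> (real ^ 'm)) \<Rightarrow> (nat \<Rightarrow> real \<times> (real ^ 'm)) \<Rightarrow> bool" where
  "frank_wolfe_run blk f A zstar K y0 y \<eta> s z \<longleftrightarrow>
    (\<forall>i. y0 i \<in> eff_dom (block_space blk i) (f i)
       \<and> f i (y0 i) = biconjugate (block_space blk i) (f i) (y0 i)) \<and>
    z 0 = (\<Sum>i\<in>UNIV. image_point f A i (y0 i)) \<and>
    (\<forall>k<K. \<forall>i.
       is_arg_min
         (\<lambda>x. ereal (fst (fw_direction zstar (z k))) * biconjugate (block_space blk i) (f i) x
              + ereal (snd (fw_direction zstar (z k)) \<bullet> (A *v x)))
         (\<lambda>x. x \<in> convex hull (eff_dom (block_space blk i) (f i)))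
         (y k i)
       \<and> y k i \<in> eff_dom (block_space blk i) (f i)
       \<and> f i (y k i) = biconjugate (block_space blk i) (f i) (y k i)) \<and>
    (\<forall>k<K. s k = (\<Sum>i\<in>UNIV. image_point f A i (y k i))) \<and>
    (\<forall>k<K. z (Suc k) = (1 - \<eta> k) *\<^sub>R z k + \<eta> k *\<^sub>R s k) \<and>
    ((\<forall>k<K. \<eta> k = 2 / (real k + 2)) \<or>
     (\<forall>k<K. if z k = s k then 0 \<le> \<eta> k \<and> \<eta> k \<le> 1
            else \<eta> k = min 1 (fw_direction zstar (z k) \<bullet> (z k - s k) / (norm (z k - s k))\<^sup>2)))"

end

theory Submission
  imports Defs
begin

text \<open>
  Write \<open>v\<^sup>k = (z\<^sup>k - z\<^sup>*)\<^sub>+\<close>.  Since \<open>v\<^sup>*\<close> is the optimal value of the convexified problem, \<open>\<C>\<close> contains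
  points \<open>c \<le> z\<^sup>* + \<epsilon> e\<^sub>0\<close> for every \<open>\<epsilon> > 0\<close>.  As \<open>v\<^sup>k \<ge> 0\<close> and \<open>s\<^sup>k\<close> minimises \<open>\<langle>v\<^sup>k, c\<rangle>\<close> over
  \<open>c \<in> \<C>\<close>, comparing with these points gives
  \<open>\<langle>v\<^sup>k, z\<^sup>k - s\<^sup>k\<rangle> \<ge> \<langle>v\<^sup>k, z\<^sup>k - z\<^sup>*\<rangle> = \<parallel>v\<^sup>k\<parallel>\<^sup>2\<close>, and the usual Frank-Wolfe recursion yields
  \<open>\<parallel>v\<^sup>k\<parallel>\<^sup>2 \<le> 4 D\<^sup>2 / (k + 2)\<close> for \<open>k \<ge> 1\<close>; convexity of \<open>\<C>\<close> plays no role.  After trimming, every block carries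
  total weight 1, so every \<open>I\<^sub>i\<close> is nonempty and at most \<open>m + 1\<close> of them have more than one element.
  Only on these at most \<open>m + 1\<close> blocks is the point changed, and replacing the combination by \<open>xhat\<^sub>i\<close> does not increase
  \<open>A\<^sub>i x\<^sub>i\<close> and costs at most \<open>\<gamma>(f\<^sub>i)\<close> in the objective.
\<close>

section \<open>Frank-Wolfe rate for the distance to an orthant\<close>

text \<open>In each coordinate, \<open>w + d\<close> is either at most 0 or bounded by
  \<open>max w 0 + d\<close>. A move of the iterate thus costs no more than the same move applied to
  its positive part, whose squared norm expands as a quadratic.\<close>

lemma norm_pos_part_add_le:
  fixes w d :: "'a::ordered_euclidean_space"
  shows "norm (sup (w + d) 0) \<le> norm (sup w 0 + d)"
  by (rule norm_le_componentwise) (auto simp: inner_Basis_sup_left inner_add_left sup_max)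

lemma inner_pos_part_self:
  fixes w :: "'a::ordered_euclidean_space"
  shows "sup w 0 \<bullet> w = (norm (sup w 0))\<^sup>2"
  unfolding power2_norm_eq_inner euclidean_inner[of _ w] euclidean_inner[of _ "sup w 0"]
  by (rule sum.cong) (auto simp: inner_Basis_sup_left sup_max)

text \<open>The short step minimises the quadratic upper model over \<open>[0, 1]\<close>.\<close>

lemma short_step_le:
  fixes G N t :: real
  assumes "0 \<le> G" "0 < N" "0 \<le> t" "t \<le> 1"
  defines "\<eta> \<equiv> min 1 (G / N)"
  shows "- 2 * \<eta> * G + \<eta>\<^sup>2 * N \<le> - 2 * t * G + t\<^sup>2 * N"
proof (cases "G \<le> N")
  case True
  then have "\<eta> = G / N"
    using assms by (simp add: \<eta>_def)
  \<comment> \<open>Completing the square around the unconstrained minimiser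
    \<open>G / N\<close>.\<close>
  moreover have "- 2 * t * G + t\<^sup>2 * N - (- 2 * (G / N) * G + (G / N)\<^sup>2 * N) = (t * N - G)\<^sup>2 / N"
    using assms(2) by (simp add: field_simps power2_eq_square)
  moreover have "0 \<le> (t * N - G)\<^sup>2 / N"
    using assms(2) by simp
  ultimately show ?thesis
    by simp
next
  case False
  then have "\<eta> = 1"
    using assms by (simp add: \<eta>_def)
  \<comment> \<open>The value of the model at \<open>t\<close> minus its value at 1 factors as
    \<open>(1 - t) * (2 * G - N * (1 + t))\<close>.\<close>
  moreover have "N * (1 + t) \<le> G * 2"
    using False assms by (intro mult_mono) auto
  then have "0 \<le> (1 - t) * (2 * G - N * (1 + t))"
    using assms by (intro mult_nonneg_nonneg) auto
  ultimately show ?thesis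
    by (simp add: algebra_simps power2_eq_square)
qed

text \<open>\<open>C\<close> is an arbitrary set of diameter at most \<open>D\<close>, so iterates
  are only located in its convex hull. By \<open>near\<close>, points of \<open>C\<close> lie below
  \<open>p\<close> up to a small multiple of \<open>u\<close>; this suffices because the directions
  \<open>v k\<close> are nonnegative.\<close>

lemma frank_wolfe_pos_part_rate:
  fixes z s :: "nat \<Rightarrow> 'a::ordered_euclidean_space" and p u :: 'a
  defines "v \<equiv> \<lambda>k. sup (z k - p) 0"
  assumes diam: "\<And>x y. x \<in> C \<Longrightarrow> y \<in> C \<Longrightarrow> norm (x - y) \<le> D"
    and z0: "z 0 \<in> C" and s: "\<And>k. k < K \<Longrightarrow> s k \<in> C"
    and step: "\<And>k. k < K \<Longrightarrow> z (Suc k) = (1 - \<eta> k) *\<^sub>R z k + \<eta> k *\<^sub>R s k"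
    and oracle_min: "\<And>k c. k < K \<Longrightarrow> c \<in> C \<Longrightarrow> v k \<bullet> s k \<le> v k \<bullet> c"
    and near: "\<And>e. 0 < e \<Longrightarrow> \<exists>c\<in>C. c \<le> p + e *\<^sub>R u"
    and steps: "(\<forall>k<K. \<eta> k = 2 / (real k + 2)) \<or>
      (\<forall>k<K. if z k = s k then 0 \<le> \<eta> k \<and> \<eta> k \<le> 1
             else \<eta> k = min 1 (v k \<bullet> (z k - s k) / (norm (z k - s k))\<^sup>2))"
    and K: "1 \<le> K"
  shows "norm (v K) \<le> 2 * D / sqrt (real K + 1)"
proof -
  have D: "0 \<le> D"
    using diam[OF z0 z0] by simp
  have gap_ge: "(norm (v k))\<^sup>2 \<le> v k \<bullet> (z k - s k)" if k: "k < K" for k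
  proof (rule field_le_epsilon)
    fix e :: real assume e: "0 < e"
    \<comment> \<open>The slack is scaled so that its contribution
      \<open>e' * (v k \<bullet> u)\<close> stays below \<open>e\<close>; the added 1 keeps the
      denominator positive.\<close>
    define e' where "e' = e / (\<bar>v k \<bullet> u\<bar> + 1)"
    have e': "0 < e'"
      using e by (simp add: e'_def)
    then obtain c where c: "c \<in> C" "c \<le> p + e' *\<^sub>R u"
      using near by blast
    have "0 \<le> v k \<bullet> (p + e' *\<^sub>R u - c)"
      using c by (intro inner_nonneg_nonneg) (auto simp: v_def)
    moreover have "e' * (v k \<bullet> u) \<le> e' * (\<bar>v k \<bullet> u\<bar> + 1)"
      using e' by (intro mult_left_mono) auto
    then have "e' * (v k \<bullet> u) \<le> e"
      by (simp add: e'_def)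
    moreover have "(norm (v k))\<^sup>2 = v k \<bullet> z k - v k \<bullet> p"
      unfolding v_def by (subst inner_pos_part_self[symmetric]) (simp add: inner_diff_right)
    ultimately show "(norm (v k))\<^sup>2 \<le> v k \<bullet> (z k - s k) + e"
      using oracle_min[OF k c(1)] by (simp add: inner_diff_right inner_add_right)
  qed
  then have gap_nonneg: "0 \<le> v k \<bullet> (z k - s k)" if "k < K" for k
    using that by (meson order_trans zero_le_power2)
  have \<eta>: "0 \<le> \<eta> k \<and> \<eta> k \<le> 1" if "k < K" for k
    using steps that gap_nonneg[OF that] by (auto split: if_splits)
  have z: "z k \<in> convex hull C" if "k \<le> K" for k
    using that
  proof (induction k)
    case 0
    show ?case
      using z0 by (simp add: hull_inc)
  next
    case (Suc k)
    then show ?case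
      using \<eta>[of k] step[of k] hull_inc[OF s[of k], of convex]
      by (auto intro!: convexD[OF convex_convex_hull])
  qed
  have zs: "norm (z k - s k) \<le> D" if "k < K" for k
  proof -
    \<comment> \<open>Balls are convex, so the distance bound passes from \<open>C\<close> to its
      hull.\<close>
    have "C \<subseteq> cball (s k) D"
      using diam s[OF that] by (auto simp: dist_norm)
    then have "convex hull C \<subseteq> cball (s k) D"
      by (rule hull_minimal) simp
    then show ?thesis
      using z[of k] that by (auto simp: dist_norm norm_minus_commute)
  qed
  \<comment> \<open>Both step rules obey the same recursion: \<open>t\<close> is always the
    open-loop step, and the short step does at least as well in the quadratic model.\<close>
  have recursion: "(norm (v (Suc k)))\<^sup>2 \<le> (1 - t) * (norm (v k))\<^sup>2 + t\<^sup>2 * D\<^sup>2"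
    if k: "k < K" and t: "t = 2 / (real k + 2)" for k t
  proof -
    define G N where "G = v k \<bullet> (z k - s k)" and "N = (norm (z k - s k))\<^sup>2"
    have t01: "0 \<le> t" "t \<le> 1"
      using t by auto
    have "z (Suc k) - p = (z k - p) + (- \<eta> k) *\<^sub>R (z k - s k)"
      using step[OF k] by (simp add: algebra_simps)
    then have "norm (v (Suc k)) \<le> norm (v k + (- \<eta> k) *\<^sub>R (z k - s k))"
      unfolding v_def by (metis norm_pos_part_add_le)
    then have "(norm (v (Suc k)))\<^sup>2 \<le> (norm (v k + (- \<eta> k) *\<^sub>R (z k - s k)))\<^sup>2"
      by (intro power_mono) auto
    also have "\<dots> = (norm (v k))\<^sup>2 + (- 2 * \<eta> k * G + (\<eta> k)\<^sup>2 * N)"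
      unfolding G_def N_def power2_norm_eq_inner
      by (simp add: inner_add_left inner_add_right inner_diff_left inner_diff_right
          inner_commute algebra_simps power2_eq_square)
    also have "- 2 * \<eta> k * G + (\<eta> k)\<^sup>2 * N \<le> - 2 * t * G + t\<^sup>2 * N"
    \<comment> \<open>If \<open>z k = s k\<close>, then \<open>G = N = 0\<close> and the model
      vanishes for every step size.\<close>
    proof (cases "z k = s k \<or> (\<forall>k<K. \<eta> k = 2 / (real k + 2))")
      case True
      then show ?thesis
        using k t by (auto simp: G_def N_def)
    next
      case False
      then have "\<eta> k = min 1 (G / N)" "0 < N"
        using steps k by (auto simp: G_def N_def)
      then show ?thesis
        using short_step_le[of G N t] gap_nonneg[OF k] t01 by (simp add: G_def)
    qed
    also have "t\<^sup>2 * N \<le> t\<^sup>2 * D\<^sup>2"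
      unfolding N_def using zs[OF k] by (intro mult_left_mono power_mono) auto
    \<comment> \<open>Half of the guaranteed decrease is given up here, which leaves the factor
      \<open>1 - t\<close> in the recursion.\<close>
    also have "- 2 * t * G \<le> - t * (norm (v k))\<^sup>2"
    proof -
      have "t * (norm (v k))\<^sup>2 \<le> t * G" "0 \<le> t * G"
        using gap_ge[OF k] gap_nonneg[OF k] t01 by (auto simp: G_def intro: mult_left_mono)
      then show ?thesis
        by simp
    qed
    finally show ?thesis
      by (simp add: algebra_simps)
  qed
  have bound: "(norm (v (Suc k)))\<^sup>2 \<le> 4 * D\<^sup>2 / (real k + 3)" if "k < K" for k
    using that
  proof (induction k)
    case 0
    \<comment> \<open>The open-loop step at \<open>k = 0\<close> equals 1 and erases the initial
      error, so no bound on \<open>v 0\<close> is required.\<close>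
    then have "(norm (v (Suc 0)))\<^sup>2 \<le> D\<^sup>2"
      using recursion[of 0 1] by simp
    moreover have "0 \<le> D\<^sup>2"
      by simp
    ultimately show ?case
      unfolding of_nat_0 add_0 by linarith
  next
    case (Suc k)
    define x where "x = real k + 3"
    have x: "3 \<le> x"
      by (simp add: x_def)
    have "(norm (v (Suc (Suc k))))\<^sup>2 \<le> (1 - 2 / x) * (norm (v (Suc k)))\<^sup>2 + (2 / x)\<^sup>2 * D\<^sup>2"
      using recursion[OF Suc.prems refl] by (simp add: x_def add_ac)
    also have "\<dots> \<le> (1 - 2 / x) * (4 * D\<^sup>2 / x) + (2 / x)\<^sup>2 * D\<^sup>2"
      using Suc x by (intro add_right_mono mult_left_mono) (auto simp: x_def)
    also have "\<dots> = 4 * D\<^sup>2 * ((x - 1) / x\<^sup>2)"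
      using x by (simp add: field_simps power2_eq_square)
    \<comment> \<open>This is \<open>(x - 1) * (x + 1) \<le> x * x\<close> after clearing
      denominators.\<close>
    also have "\<dots> \<le> 4 * D\<^sup>2 * (1 / (x + 1))"
      using x by (intro mult_left_mono) (auto simp: field_simps power2_eq_square)
    finally show ?case
      by (simp add: x_def add_ac)
  qed
  \<comment> \<open>The induction gives the denominator \<open>K + 2\<close>, which is then weakened
    to \<open>K + 1\<close>.\<close>
  have "(norm (v K))\<^sup>2 \<le> 4 * D\<^sup>2 / (real (K - 1) + 3)"
    using bound[of "K - 1"] K by simp
  also have "\<dots> \<le> 4 * D\<^sup>2 / (real K + 1)"
    using K by (intro divide_left_mono) auto
  also have "\<dots> = (2 * D / sqrt (real K + 1))\<^sup>2"
    by (simp add: power_divide power_mult_distrib)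
  finally show ?thesis
    by (rule power2_le_imp_le) (use D in simp)
qed

section \<open>Finiteness of the biconjugate, elementary bounds and counting\<close>

text \<open>The slope of an affine minorant has a conjugate value bounded above, which bounds the
  biconjugate below. Finiteness ensures that \<open>real_of_ereal\<close> in \<open>C_block\<close>
  loses no information.\<close>

lemma biconjugate_finite:
  fixes g :: "'a::real_inner \<Rightarrow> ereal"
  assumes proper: "proper_on E g" and minorant: "has_affine_minorant_on E g"
    and x: "x \<in> convex hull (eff_dom E g)"
  shows "\<bar>biconjugate E g x\<bar> \<noteq> \<infinity>"
proof -
  obtain a c where a: "a \<in> E" and minor: "\<And>y. y \<in> E \<Longrightarrow> ereal (a \<bullet> y + c) \<le> g y"
    using minorant unfolding has_affine_minorant_on_def by blast
  have "fenchel_conjugate E g a \<le> ereal (- c)"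
    unfolding fenchel_conjugate_def
  proof (rule SUP_least)
    fix y assume "y \<in> E"
    then show "ereal (a \<bullet> y) - g y \<le> ereal (- c)"
      using minor[of y] by (cases "g y") auto
  qed
  then have "ereal (x \<bullet> a) - ereal (- c) \<le> ereal (x \<bullet> a) - fenchel_conjugate E g a"
    by (intro ereal_minus_mono) auto
  also have "\<dots> \<le> biconjugate E g x"
    unfolding biconjugate_def fenchel_conjugate_def[of E "fenchel_conjugate E g"]
    using a by (rule SUP_upper)
  finally have lower: "biconjugate E g x \<noteq> -\<infinity>"
    by auto
  \<comment> \<open>\<open>g\<close> may be unbounded above on its domain, so the upper bound is taken over the finitely many
      points of a convex combination.\<close>
  obtain T where T: "finite T" "T \<subseteq> eff_dom E g" "x \<in> convex hull T"
    using x unfolding convex_hull_explicit[of "eff_dom E g"]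
    by (auto simp: convex_hull_finite)
  define r where "r y = real_of_ereal (g y)" for y
  have r: "g y = ereal (r y)" if "y \<in> T" for y
    using that T proper
    by (cases "g y") (auto simp: r_def eff_dom_def proper_on_def)
  define M where "M = (\<Sum>y\<in>T. \<bar>r y\<bar>)"
  have M: "r y \<le> M" if "y \<in> T" for y
    using member_le_sum[OF that, of "\<lambda>y. \<bar>r y\<bar>"] T by (simp add: M_def)
  have "biconjugate E g x \<le> ereal M"
    unfolding biconjugate_def fenchel_conjugate_def[of E "fenchel_conjugate E g"]
  proof (rule SUP_least)
    fix t assume t: "t \<in> E"
    have conj_ge: "ereal (t \<bullet> y) - g y \<le> fenchel_conjugate E g t" if "y \<in> E" for y
      unfolding fenchel_conjugate_def using that by (rule SUP_upper)
    show "ereal (x \<bullet> t) - fenchel_conjugate E g t \<le> ereal M"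
    proof (cases "fenchel_conjugate E g t")
      case (real c')
      \<comment> \<open>The desired bound says that \<open>x\<close> lies in a halfspace, so it is
        enough to check the points of \<open>T\<close>.\<close>
      have "T \<subseteq> {y. t \<bullet> y \<le> M + c'}"
      proof
        fix y assume y: "y \<in> T"
        then have "y \<in> E"
          using T by (auto simp: eff_dom_def)
        then show "y \<in> {y. t \<bullet> y \<le> M + c'}"
          using conj_ge[of y] M[OF y] r[OF y] real by auto
      qed
      then have "convex hull T \<subseteq> {y. t \<bullet> y \<le> M + c'}"
        by (rule hull_minimal) (rule convex_halfspace_le)
      then show ?thesis
        using T real by (auto simp: inner_commute)
    next
      case PInf
      then show ?thesis by simp
    next
      case MInf
      obtain y where "y \<in> E" "g y \<noteq> \<infinity>" "g y \<noteq> -\<infinity>"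
        using proper by (auto simp: proper_on_def)
      then show ?thesis
        using conj_ge[of y] MInf by (cases "g y") auto
    qed
  qed
  then show ?thesis
    using lower by (cases "biconjugate E g x") auto
qed

lemma eff_dom_diff_le_gap:
  assumes "x \<in> eff_dom E g" "y \<in> eff_dom E g"
  shows "g x - g y \<le> gap E g"
  unfolding gap_def using assms by (intro ereal_minus_mono SUP_upper INF_lower)

lemma ediam_upper:
  assumes "x \<in> C" "y \<in> C"
  shows "ereal (norm (x - y)) \<le> ediam C"
  unfolding ediam_def using assms by (meson SUP_upper2 SUP_upper order_trans)

lemma norm_plus_mono:
  assumes "x \<le> y"
  shows "norm_plus x \<le> norm_plus y"
  unfolding norm_plus_def using assms
  by (intro real_sqrt_le_mono sum_mono power_mono max.mono) (auto simp: less_eq_vec_def)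

lemma pos_part_Pair:
  fixes a :: real and q :: "real ^ 'm::finite"
  shows "sup (a, q) 0 = (max a 0, sup q 0)"
  by (simp add: sup_prod_def zero_prod_def sup_max)

lemma norm_plus_eq: "norm_plus q = norm (sup q 0)"
  by (simp add: norm_plus_def norm_vec_def L2_set_def sup_vec_def sup_max)

text \<open>Every fibre is nonempty and contributes 1, and one more if it has several elements. With
  \<open>n + m + 1\<close> indices spread over all \<open>n\<close> blocks, at most
  \<open>m + 1\<close> blocks are split.\<close>

lemma card_multi_fibres_le:
  assumes "finite L" "finite B" "il ` L = B"
  shows "card B + card {i\<in>B. 1 < card {l\<in>L. il l = i}} \<le> card L"
proof -
  have "card B + card {i\<in>B. 1 < card {l\<in>L. il l = i}}
      = (\<Sum>i\<in>B. 1 + (if 1 < card {l\<in>L. il l = i} then 1 else 0))"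
    using assms(2) by (simp only: sum.distrib) (simp add: sum.If_cases Int_def)
  also have "\<dots> \<le> (\<Sum>i\<in>B. card {l\<in>L. il l = i})"
  proof (rule sum_mono)
    fix i assume "i \<in> B"
    then have "{l\<in>L. il l = i} \<noteq> {}"
      using assms(3) by auto
    then have "0 < card {l\<in>L. il l = i}"
      using assms(1) by (simp add: card_gt_0_iff)
    then show "1 + (if 1 < card {l\<in>L. il l = i} then 1 else 0) \<le> card {l\<in>L. il l = i}"
      by auto
  qed
  also have "\<dots> = card L"
    using sum.group[of L B il "\<lambda>_. 1::nat"] assms by simp
  finally show ?thesis .
qed

text \<open>Reduces membership in the Minkowski sum to choosing one point per block.\<close>

lemma mem_C_sum_iff:
  "c \<in> C_sum blk f A \<longleftrightarrow> (\<exists>x. (\<forall>i. x i \<in> convex hull (eff_dom (block_space blk i) (f i))) \<and>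
    c = (\<Sum>i\<in>UNIV. (real_of_ereal (biconjugate (block_space blk i) (f i) (x i)), A *v x i)))"
proof -
  have "c \<in> C_sum blk f A \<longleftrightarrow> (\<exists>w. (\<forall>i. w i \<in> C_block blk f A i) \<and> c = sum w UNIV)"
    unfolding C_sum_def by (subst set_sum_alt) auto
  also have "\<dots> \<longleftrightarrow> (\<exists>x. (\<forall>i. x i \<in> convex hull (eff_dom (block_space blk i) (f i))) \<and>
    c = (\<Sum>i\<in>UNIV. (real_of_ereal (biconjugate (block_space blk i) (f i) (x i)), A *v x i)))"
  proof safe
    fix w assume "\<forall>i. w i \<in> C_block blk f A i"
    then have "\<forall>i. \<exists>x. x \<in> convex hull (eff_dom (block_space blk i) (f i)) \<and>
        w i = (real_of_ereal (biconjugate (block_space blk i) (f i) x), A *v x)"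
      unfolding C_block_def by blast
    then obtain x where x: "\<And>i. x i \<in> convex hull (eff_dom (block_space blk i) (f i)) \<and>
        w i = (real_of_ereal (biconjugate (block_space blk i) (f i) (x i)), A *v x i)"
      by metis
    then show "\<exists>x. (\<forall>i. x i \<in> convex hull (eff_dom (block_space blk i) (f i))) \<and> sum w UNIV =
      (\<Sum>i\<in>UNIV. (real_of_ereal (biconjugate (block_space blk i) (f i) (x i)), A *v x i))"
      by (intro exI[of _ x]) simp
  next
    fix x assume "\<forall>i. x i \<in> convex hull (eff_dom (block_space blk i) (f i))"
    then show "\<exists>w. (\<forall>i. w i \<in> C_block blk f A i) \<and>
      (\<Sum>i\<in>UNIV. (real_of_ereal (biconjugate (block_space blk i) (f i) (x i)), A *v x i)) = sum w UNIV"
      unfolding C_block_def by (intro exI conjI allI imageI refl) auto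
  qed
  finally show ?thesis .
qed


theorem theorem3p4:
  fixes blk :: "'d::finite \<Rightarrow> 'n::finite"
    and f :: "'n \<Rightarrow> real ^ 'd \<Rightarrow> ereal"
    and A :: "real ^ 'd ^ 'm::finite"
    and b :: "real ^ 'm"
    and vstar :: real
    and K :: nat
    and y0 :: "'n \<Rightarrow> real ^ 'd"
    and y :: "nat \<Rightarrow> 'n \<Rightarrow> real ^ 'd"
    and \<eta> \<gamma> :: "nat \<Rightarrow> real"
    and s z :: "nat \<Rightarrow> real \<times> (real ^ 'm)"
    and \<alpha> :: "nat \<Rightarrow> real"
    and il :: "nat \<Rightarrow> 'n"
    and kl :: "nat \<Rightarrow> nat"
    and L :: "nat set"
    and xhat xbar :: "'n \<Rightarrow> real ^ 'd"
  defines "X \<equiv> \<lambda>i. eff_dom (block_space blk i) (f i)"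
    and "L \<equiv> {1 .. CARD('n) + CARD('m) + 1}"
    and "I \<equiv> \<lambda>i. {l \<in> L. il l = i}"
  assumes proper: "\<And>i. proper_on (block_space blk i) (f i)"
    and lsc: "\<And>i. lsc_on (block_space blk i) (f i)"
    and minorant: "\<And>i. has_affine_minorant_on (block_space blk i) (f i)"
    and compact_dom: "\<And>i. compact (X i)"
    and dual_max: "\<exists>lam. 0 \<le> lam \<and> dual_function blk f A b lam = ereal vstar"
        "\<And>lam. 0 \<le> lam \<Longrightarrow> dual_function blk f A b lam \<le> ereal vstar"
    and strong_duality: "ereal vstar = convexified_value blk f A b"
    and domination: "\<And>i x. x \<in> convex hull (X i) \<Longrightarrow> \<exists>x'\<in>X i. A *v x' \<le> A *v x"
    and K: "K \<ge> 1"
    and fw: "frank_wolfe_run blk f A (vstar, b) K y0 y \<eta> s z"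
    and simplex: "\<And>k. k < K \<Longrightarrow> 0 \<le> \<gamma> k" "(\<Sum>k<K. \<gamma> k) = 1"
    and output_repr: "z K = (\<Sum>k<K. \<gamma> k *\<^sub>R s k)"
    and trim_range: "\<And>l. l \<in> L \<Longrightarrow> 0 \<le> \<alpha> l" "\<And>l. l \<in> L \<Longrightarrow> kl l < K"
    and trim: "(z K, \<chi> i. 1) =
        (\<Sum>l\<in>L. \<alpha> l *\<^sub>R (image_point f A (il l) (y (kl l) (il l)), axis (il l) (1::real)))"
    and xhat: "\<And>i. card (I i) > 1 \<Longrightarrow>
        xhat i \<in> X i \<and> A *v xhat i \<le> A *v (\<Sum>l\<in>I i. \<alpha> l *\<^sub>R y (kl l) i)"
    and xbar_single: "\<And>i. card (I i) = 1 \<Longrightarrow> xbar i = (\<Sum>l\<in>I i. \<alpha> l *\<^sub>R y (kl l) i)"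
    and xbar_multi: "\<And>i. card (I i) > 1 \<Longrightarrow> xbar i = xhat i"
  shows "(\<Sum>i\<in>UNIV. f i (xbar i))
           \<le> ereal vstar + 2 * ediam (C_sum blk f A) / ereal (sqrt (real K + 1))
             + ereal (real CARD('m) + 1) * Max (range (\<lambda>i. gap (block_space blk i) (f i)))
      \<and> ereal (norm_plus ((\<Sum>i\<in>UNIV. A *v xbar i) - b))
           \<le> 2 * ediam (C_sum blk f A) / ereal (sqrt (real K + 1))"
proof -

  \<comment> \<open>The run as an instance of the abstract rate\<close>
  define F where "F i x = real_of_ereal (biconjugate (block_space blk i) (f i) x)" for i x
  have F: "biconjugate (block_space blk i) (f i) x = ereal (F i x)" if "x \<in> convex hull (X i)" for i x
    using biconjugate_finite[OF proper minorant] that unfolding F_def X_def by (simp add: ereal_real)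
  define C where "C = C_sum blk f A"
  have C_iff: "c \<in> C \<longleftrightarrow> (\<exists>x. (\<forall>i. x i \<in> convex hull (X i)) \<and> c = (\<Sum>i\<in>UNIV. (F i (x i), A *v x i)))" for c
    unfolding C_def F_def X_def by (rule mem_C_sum_iff)
  define v where "v k = sup (z k - (vstar, b)) 0" for k
  have y0: "y0 i \<in> X i" "f i (y0 i) = biconjugate (block_space blk i) (f i) (y0 i)" for i
    using fw unfolding frank_wolfe_run_def X_def by blast+
  have y: "y k i \<in> X i" "f i (y k i) = biconjugate (block_space blk i) (f i) (y k i)" if "k < K" for k i
    using fw that unfolding frank_wolfe_run_def X_def by blast+
  have y_hull: "y k i \<in> convex hull (X i)" if "k < K" for k i
    using y(1)[OF that] by (rule hull_inc)
  have y_F: "f i (y k i) = ereal (F i (y k i))" if "k < K" for k i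
    using y(2)[OF that] F[OF y_hull[OF that]] by simp
  have y0_F: "f i (y0 i) = ereal (F i (y0 i))" for i
    using y0 F hull_inc by metis
  have s_eq: "s k = (\<Sum>i\<in>UNIV. (F i (y k i), A *v y k i))" if "k < K" for k
    using fw that y_F unfolding frank_wolfe_run_def image_point_def by simp
  have s: "s k \<in> C" if "k < K" for k
    unfolding C_iff using s_eq y_hull that by blast
  have "z 0 = (\<Sum>i\<in>UNIV. (F i (y0 i), A *v y0 i))"
    using fw y0_F unfolding frank_wolfe_run_def image_point_def by simp
  then have z0: "z 0 \<in> C"
    unfolding C_iff using y0(1) hull_inc by metis
  have oracle_min: "v k \<bullet> s k \<le> v k \<bullet> c" if k: "k < K" and c: "c \<in> C" for k c
  proof -
    obtain x where x: "\<And>i. x i \<in> convex hull (X i)" "c = (\<Sum>i\<in>UNIV. (F i (x i), A *v x i))"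
      using c unfolding C_iff by blast
    \<comment> \<open>The linear functional splits over the blocks, so the blockwise minimisers
      together minimise it over the whole of \<open>C\<close>.\<close>
    have "v k \<bullet> (F i (y k i), A *v y k i) \<le> v k \<bullet> (F i (x i), A *v x i)" for i
    proof -
      have "is_arg_min
         (\<lambda>x. ereal (fst (v k)) * biconjugate (block_space blk i) (f i) x
              + ereal (snd (v k) \<bullet> (A *v x)))
         (\<lambda>x. x \<in> convex hull (X i)) (y k i)"
        using fw k unfolding frank_wolfe_run_def X_def v_def fw_direction_def by blast
      then have "\<not> ereal (fst (v k)) * biconjugate (block_space blk i) (f i) (x i)
              + ereal (snd (v k) \<bullet> (A *v x i))
            < ereal (fst (v k)) * biconjugate (block_space blk i) (f i) (y k i)
              + ereal (snd (v k) \<bullet> (A *v y k i))"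
        using x(1) unfolding is_arg_min_def by blast
      then show ?thesis
        using F[OF x(1)] F[OF y_hull[OF k]] by (simp add: inner_prod_def)
    qed
    then show ?thesis
      unfolding s_eq[OF k] x(2) inner_sum_right by (intro sum_mono)
  qed
  have near: "\<exists>c\<in>C. c \<le> (vstar, b) + e *\<^sub>R (1, 0)" if "0 < e" for e
  proof -
    \<comment> \<open>Strong duality enters here. A feasible point of value below
      \<open>vstar + e\<close> avoids any appeal to attainment, and slack is needed only in the
      objective coordinate, hence the direction \<open>(1, 0)\<close>.\<close>
    have "convexified_value blk f A b < ereal (vstar + e)"
      using strong_duality[symmetric] that by simp
    then obtain x where x: "\<And>i. x i \<in> convex hull (X i)" "(\<Sum>i\<in>UNIV. A *v x i) \<le> b"
      "(\<Sum>i\<in>UNIV. biconjugate (block_space blk i) (f i) (x i)) < ereal (vstar + e)"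
      unfolding convexified_value_def INF_less_iff X_def by blast
    have "(\<Sum>i\<in>UNIV. F i (x i)) < vstar + e"
      using x(3) F[OF x(1)] by simp
    then show ?thesis
      using x by (intro bexI[of _ "\<Sum>i\<in>UNIV. (F i (x i), A *v x i)"])
        (auto simp: C_iff sum_prod fst_sum snd_sum less_eq_prod_def)
  qed

  \<comment> \<open>Blockwise reading of the trimmed representation\<close>
  have finI: "finite (I i)" for i
    by (simp add: I_def L_def)
  have finL: "finite L"
    by (simp add: L_def)
  have I_K: "kl l < K" if "l \<in> I i" for l i
    using that trim_range by (auto simp: I_def)
  have I_\<alpha>: "0 \<le> \<alpha> l" if "l \<in> I i" for l i
    using that trim_range by (auto simp: I_def)
  have group: "(\<Sum>l\<in>L. h (il l) l) = (\<Sum>i\<in>UNIV. \<Sum>l\<in>I i. h i l)" for h :: "'n \<Rightarrow> nat \<Rightarrow> 'c::comm_monoid_add"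
  proof -
    have "(\<Sum>l\<in>L. h (il l) l) = (\<Sum>i\<in>UNIV. \<Sum>l\<in>I i. h (il l) l)"
      unfolding I_def by (rule sum.group[symmetric]) (use finL in auto)
    also have "\<dots> = (\<Sum>i\<in>UNIV. \<Sum>l\<in>I i. h i l)"
      by (intro sum.cong refl) (simp add: I_def)
    finally show ?thesis .
  qed
  have \<alpha>_sum: "(\<Sum>l\<in>I i. \<alpha> l) = 1" for i
  proof -
    \<comment> \<open>The appended unit vectors record the total weight given to each block.\<close>
    have "1 = snd (z K, (\<chi> i. 1) :: real ^ 'n) $ i"
      by simp
    also have "\<dots> = (\<Sum>l\<in>L. \<alpha> l * axis (il l) 1 $ i)"
      unfolding trim by (simp add: snd_sum)
    also have "\<dots> = (\<Sum>l\<in>L. if il l = i then \<alpha> l else 0)"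
      by (rule sum.cong) (auto simp: axis_def)
    also have "\<dots> = (\<Sum>l\<in>I i. \<alpha> l)"
      unfolding I_def using finL by (rule sum.inter_filter[symmetric])
    finally show ?thesis by simp
  qed
  \<comment> \<open>\<open>q i\<close> averages the values at the selected points, whereas
    \<open>w i\<close> averages the points themselves.\<close>
  define q where "q i = (\<Sum>l\<in>I i. \<alpha> l * F i (y (kl l) i))" for i
  define w where "w i = (\<Sum>l\<in>I i. \<alpha> l *\<^sub>R y (kl l) i)" for i
  have zK: "z K = (\<Sum>i\<in>UNIV. (q i, A *v w i))"
  proof -
    have "z K = (\<Sum>l\<in>L. \<alpha> l *\<^sub>R image_point f A (il l) (y (kl l) (il l)))"
      using arg_cong[OF trim, of fst] by (simp add: fst_sum)
    also have "\<dots> = (\<Sum>i\<in>UNIV. \<Sum>l\<in>I i. \<alpha> l *\<^sub>R image_point f A i (y (kl l) i))"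
      by (rule group)
    also have "\<dots> = (\<Sum>i\<in>UNIV. (q i, A *v w i))"
    proof (rule sum.cong[OF refl])
      fix i
      have "(\<Sum>l\<in>I i. \<alpha> l *\<^sub>R image_point f A i (y (kl l) i))
          = (\<Sum>l\<in>I i. (\<alpha> l * F i (y (kl l) i), A *v (\<alpha> l *\<^sub>R y (kl l) i)))"
        by (rule sum.cong)
          (simp_all add: image_point_def y_F I_K matrix_vector_mult_scaleR)
      also have "\<dots> = (q i, A *v w i)"
        by (simp add: sum_prod q_def w_def linear_sum[OF matrix_vector_mul_linear])
      finally show "(\<Sum>l\<in>I i. \<alpha> l *\<^sub>R image_point f A i (y (kl l) i)) = (q i, A *v w i)" .
    qed
    finally show ?thesis .
  qed
  have I_ne: "I i \<noteq> {}" for i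
    using \<alpha>_sum[of i] by auto
  have xbar_cases: "(xbar i \<in> X i \<and> f i (xbar i) = ereal (q i) \<and> A *v xbar i \<le> A *v w i) \<or>
      (1 < card (I i) \<and> xbar i \<in> X i \<and> A *v xbar i \<le> A *v w i)" for i
  proof (cases "1 < card (I i)")
    case True
    then show ?thesis
      using xhat xbar_multi by (simp add: w_def)
  next
    case False
    moreover have "0 < card (I i)"
      using I_ne finI by (simp add: card_gt_0_iff)
    ultimately have card: "card (I i) = 1"
      by simp
    then obtain l where l: "I i = {l}"
      by (rule card_1_singletonE)
    \<comment> \<open>A block with a single index has weight 1 on it, so its average is a genuine
      oracle point in \<open>X i\<close>.\<close>
    then have "\<alpha> l = 1" "kl l < K"
      using \<alpha>_sum[of i] I_K[of l i] by auto
    then show ?thesis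
      using xbar_single[OF card] y(1) y_F l by (simp add: q_def w_def)
  qed
  have A_le: "A *v xbar i \<le> A *v w i" for i
    using xbar_cases[of i] by auto
  have xbar_X: "xbar i \<in> X i" for i
    using xbar_cases[of i] by auto
  define G where "G = Max (range (\<lambda>i. gap (block_space blk i) (f i)))"
  have gap_le: "gap (block_space blk i) (f i) \<le> G" for i
    unfolding G_def by (intro Max_ge) auto
  have f_finite: "\<bar>f i x\<bar> \<noteq> \<infinity>" if "x \<in> X i" for i x
    using that proper[of i] by (auto simp: X_def eff_dom_def proper_on_def)
  have gap_diff: "f i x - f i x' \<le> G" if "x \<in> X i" "x' \<in> X i" for i x x'
    using eff_dom_diff_le_gap[of x _ _ x'] gap_le[of i] that unfolding X_def by (blast intro: order_trans)
  \<comment> \<open>Compares a point with itself; \<open>undefined\<close> merely names some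
    block.\<close>
  have G_nonneg: "0 \<le> G"
    using gap_diff[OF xbar_X xbar_X, of undefined] f_finite[OF xbar_X, of undefined]
    by (cases "f undefined (xbar undefined)") auto
  have ediam_nonneg: "0 \<le> ediam C"
    using ediam_upper[OF z0 z0] by (simp add: zero_ereal_def)
  define r where "r = sqrt (real K + 1)"
  have r: "0 < r"
    by (simp add: r_def)
  have rate: "norm (v K) \<le> 2 * D / r" if D: "ediam C = ereal D" for D
    unfolding v_def r_def
  proof (rule frank_wolfe_pos_part_rate[where C = C and s = s and \<eta> = \<eta> and u = "(1, 0)"])
    show "norm (x - x') \<le> D" if "x \<in> C" "x' \<in> C" for x x'
      using ediam_upper[OF that] D by simp
    show "(\<forall>k<K. \<eta> k = 2 / (real k + 2)) \<or>
      (\<forall>k<K. if z k = s k then 0 \<le> \<eta> k \<and> \<eta> k \<le> 1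
             else \<eta> k = min 1 (sup (z k - (vstar, b)) 0 \<bullet> (z k - s k) / (norm (z k - s k))\<^sup>2))"
      and "\<And>k. k < K \<Longrightarrow> z (Suc k) = (1 - \<eta> k) *\<^sub>R z k + \<eta> k *\<^sub>R s k"
      using fw unfolding frank_wolfe_run_def fw_direction_def by blast+
  qed (use z0 s oracle_min near K in \<open>auto simp: v_def\<close>)
  have vK: "v K = (max ((\<Sum>i\<in>UNIV. q i) - vstar) 0, sup ((\<Sum>i\<in>UNIV. A *v w i) - b) 0)"
    unfolding v_def zK by (simp add: sum_prod pos_part_Pair)

  \<comment> \<open>Derivation of the two bounds; an infinite diameter makes both trivial\<close>
  show ?thesis
  proof (cases "ediam C")
    case (real D)
    have "norm_plus ((\<Sum>i\<in>UNIV. A *v xbar i) - b) \<le> norm_plus ((\<Sum>i\<in>UNIV. A *v w i) - b)"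
      using A_le by (intro norm_plus_mono diff_right_mono sum_mono)
    also have "\<dots> \<le> norm (v K)"
      unfolding norm_plus_eq vK by (rule norm_snd_le)
    also have "\<dots> \<le> 2 * D / r"
      by (rule rate[OF real])
    finally have infeasibility: "norm_plus ((\<Sum>i\<in>UNIV. A *v xbar i) - b) \<le> 2 * D / r" .
    have "(\<Sum>i\<in>UNIV. q i) - vstar \<le> norm (fst (v K))"
      unfolding vK by simp
    also have "\<dots> \<le> norm (v K)"
      by (metis norm_fst_le prod.collapse)
    finally have objective: "(\<Sum>i\<in>UNIV. q i) \<le> vstar + 2 * D / r"
      using rate[OF real] by simp
    have "(\<Sum>i\<in>UNIV. f i (xbar i)) \<le> ereal vstar + ereal (2 * D / r) + ereal (real CARD('m) + 1) * G"
    \<comment> \<open>An infinite oscillation also makes the objective bound trivial, since its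
      coefficient is positive.\<close>
    proof (cases G)
      case G: (real g)
      have g: "0 \<le> g"
        using G_nonneg G by simp
      define S where "S = {i. 1 < card (I i)}"
      have card_S: "card S \<le> CARD('m) + 1"
      proof -
        have "i \<in> il ` L" for i
          using I_ne[of i] by (auto simp: I_def)
        then have "il ` L = UNIV"
          by blast
        then have "CARD('n) + card S \<le> card L"
          using card_multi_fibres_le[OF finL, of UNIV il] by (simp add: S_def I_def)
        then show ?thesis
          by (simp add: L_def)
      qed
      have f_le: "f i (xbar i) \<le> ereal (q i + (if i \<in> S then g else 0))" for i
        using xbar_cases[of i]
      proof
        assume "xbar i \<in> X i \<and> f i (xbar i) = ereal (q i) \<and> A *v xbar i \<le> A *v w i"
        then show ?thesis
          using g by simp
      next
        assume i: "1 < card (I i) \<and> xbar i \<in> X i \<and> A *v xbar i \<le> A *v w i"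
        obtain t where t: "f i (xbar i) = ereal t"
          using f_finite[OF xbar_X[of i]] by (cases "f i (xbar i)") auto
        \<comment> \<open>The oscillation bound holds against every selected point of the block.
          Averaging with weights of sum 1 then charges \<open>g\<close> only once.\<close>
        have t_le: "t \<le> F i (y (kl l) i) + g" if "l \<in> I i" for l
          using gap_diff[OF xbar_X y(1)[OF I_K[OF that], of i]] t y_F[OF I_K[OF that], of i] G
          by (simp add: algebra_simps)
        have "t = (\<Sum>l\<in>I i. \<alpha> l * t)"
          using \<alpha>_sum[of i] by (simp flip: sum_distrib_right)
        also have "\<dots> \<le> (\<Sum>l\<in>I i. \<alpha> l * (F i (y (kl l) i) + g))"
          using t_le I_\<alpha> by (intro sum_mono mult_left_mono)
        also have "\<dots> = q i + g"
          using \<alpha>_sum[of i] by (simp add: q_def distrib_left sum.distrib flip: sum_distrib_right)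
        finally show ?thesis
          using i t by (simp add: S_def)
      qed
      have "(\<Sum>i\<in>UNIV. f i (xbar i)) \<le> (\<Sum>i\<in>UNIV. ereal (q i + (if i \<in> S then g else 0)))"
        using f_le by (intro sum_mono)
      also have "\<dots> = ereal ((\<Sum>i\<in>UNIV. q i) + real (card S) * g)"
        by (simp add: sum.distrib sum.If_cases)
      also have "\<dots> \<le> ereal (vstar + 2 * D / r + (real CARD('m) + 1) * g)"
        unfolding ereal_less_eq using objective card_S g by (intro add_mono mult_right_mono) auto
      finally show ?thesis
        using G by simp
    next
      case PInf
      then show ?thesis by simp
    next
      case MInf
      then show ?thesis using G_nonneg by simp
    qed
    moreover have "2 * ediam C / ereal r = ereal (2 * D / r)"
      using real r by (simp add: ereal_divide)
    ultimately show ?thesis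
      using infeasibility unfolding C_def G_def r_def by simp
  next
    case PInf
    have "2 * ediam C / ereal r = \<infinity>"
      using PInf r by (simp add: divide_ereal_def)
    moreover have "0 \<le> ereal (real CARD('m) + 1) * G"
      using G_nonneg by (intro ereal_0_le_mult) auto
    ultimately show ?thesis
      unfolding C_def G_def r_def by simp
  next
    case MInf
    then show ?thesis using ediam_nonneg by simp
  qed
qed

end
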